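(* For every natural number $k\ge 1$, every real $s$ with $0<s\le 2$, and every constant $C_0>0$, there exist constants $C>0$ and $N$, depending only on $k$, $s$ and $C_0$, such that the following holds for every $n>N$. Let $E\subset[0,1]^2$ be a set of $n$ points that is $s$-adaptable with energy constant $C_0$, and let $(\alpha_1,\dots,\alpha_k)$ be a $k$-tuple of nonzero real numbers. Then the number of $k$-chains of type $(\alpha_1,\dots,\alpha_k)$ in $E$ is at most $$C\cdot\begin{cases} (\log_2 n)^{\frac{2k-6}{3}}\, n^{\frac{4k+12}{9}+\frac{k-3}{3s}} & \text{if } k\equiv 0 \pmod 3,\\ (\log_2 n)^{\frac{2k-2}{3}}\, n^{\frac{4k+8}{9}+\frac{k-1}{3s}} & \text{if } k\equiv 1 \pmod 3,\\ (\log_2 n)^{\frac{2k+2}{3}}\, n^{\frac{4k+4}{9}+\frac{k+1}{3s}} & \text{if } k\equiv 2 \pmod 3. \end{cases}$$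
   Context: For a $k$-tuple $(\alpha_1,\dots,\alpha_k)$ of real numbers, a $k$-chain of type $(\alpha_1,\dots,\alpha_k)$ in a finite set $E$ is a $(k+1)$-tuple $(R_1,\dots,R_{k+1})\in E^{k+1}$ such that $R_j\cdot R_{j+1}=\alpha_j$ for all $j=1,\dots,k$, where $\cdot$ is the standard dot product. Repetitions among the $R_j$ are not excluded. A set $E\subset[0,1]^2$ of $n$ points is $s$-adaptable (with energy constant $C_0$, a constant independent of $n$) if both of the following hold: (energy) $\displaystyle \frac{1}{\binom{n}{2}}\sum_{P,Q\in E,\,P\ne Q}|P-Q|^{-s}\le C_0$; (separation) $\displaystyle \min\{|P-Q|: P,Q\in E,\ P\neq Q\}\ge n^{-1/s}$. *)

theory Defs
  imports "HOL-Analysis.Analysis"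
begin

definition unit_square :: "(real ^ 2) set" where
  "unit_square = {P. \<forall>i. 0 \<le> P $ i \<and> P $ i \<le> 1}"

text \<open>
  The energy sum ranges over ordered pairs of distinct points. The separation condition
  spells out the lower bound on the minimal distance; this way it is also meaningful
  (vacuous) for sets with fewer than two points.
\<close>

definition adaptable :: "real \<Rightarrow> real \<Rightarrow> nat \<Rightarrow> (real ^ 2) set \<Rightarrow> bool" where
  "adaptable s C0 n E \<longleftrightarrow>
     finite E \<and> card E = n \<and> E \<subseteq> unit_square \<and>
     1 / real (n choose 2) * (\<Sum>(P, Q) \<in> {(P, Q). P \<in> E \<and> Q \<in> E \<and> P \<noteq> Q}. dist P Q powr (- s)) \<le> C0 \<and>
     (\<forall>P\<in>E. \<forall>Q\<in>E. P \<noteq> Q \<longrightarrow> dist P Q \<ge> real n powr (- 1 / s))"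

text \<open>
  The type is the list \<open>\<alpha>s\<close>, whose length is \<open>k\<close>; list indices start at 0, so entry \<open>j\<close> of
  \<open>\<alpha>s\<close> prescribes the dot product of entries \<open>j\<close> and \<open>j + 1\<close> of the chain.
\<close>

definition k_chains :: "real list \<Rightarrow> (real ^ 2) set \<Rightarrow> (real ^ 2) list set" where
  "k_chains \<alpha>s E =
     {R. length R = length \<alpha>s + 1 \<and> set R \<subseteq> E \<and>
         (\<forall>j < length \<alpha>s. R ! j \<bullet> R ! (j + 1) = \<alpha>s ! j)}"

definition chain_bound :: "nat \<Rightarrow> real \<Rightarrow> nat \<Rightarrow> real" where
  "chain_bound k s n =
     (if k mod 3 = 0 then
        log 2 (real n) powr ((2 * real k - 6) / 3) *
        real n powr ((4 * real k + 12) / 9 + (real k - 3) / (3 * s))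
      else if k mod 3 = 1 then
        log 2 (real n) powr ((2 * real k - 2) / 3) *
        real n powr ((4 * real k + 8) / 9 + (real k - 1) / (3 * s))
      else
        log 2 (real n) powr ((2 * real k + 2) / 3) *
        real n powr ((4 * real k + 4) / 9 + (real k + 1) / (3 * s)))"

end

theory Submission
  imports Defs
begin

text \<open>
  Two ingredients bound all chain counts. First, for \<open>\<alpha> \<noteq> 0\<close> the points \<open>P\<close> with \<open>P \<bullet> Q = \<alpha>\<close>
  lie on a line that determines \<open>Q\<close>. So pairs of points of \<open>E\<close> with dot product \<open>\<alpha>\<close> are incidences
  between \<open>n\<close> points and \<open>n\<close> lines, and the Szemeredi-Trotter theorem bounds their number by
  \<open>11 n powr (4/3)\<close> (\<open>card_dot_pairs_le\<close>). Second, the separation condition allows at most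
  \<open>3 n powr (1/s)\<close> points of \<open>E\<close> on one line (\<open>card_on_line_le\<close>), so prolonging a chain by one point
  costs at most that factor.

  In a chain \<open>P\<^sub>1, P\<^sub>2, P\<^sub>3, P\<^sub>4, \<dots>\<close>, ignore the condition linking \<open>P\<^sub>2\<close> to \<open>P\<^sub>3\<close>. Then \<open>(P\<^sub>1, P\<^sub>2)\<close> is a
  pair with prescribed dot product, \<open>P\<^sub>3\<close> lies on a line determined by \<open>P\<^sub>4\<close>, and the rest is a
  chain of a type shorter by three. Each block of three steps therefore costs
  \<open>n powr (4/3 + 1/s)\<close>, up to a constant, which is exactly the growth of the bound apart from its
  logarithm. The lengths one, two and three start the induction: they cost \<open>n powr (4/3)\<close>,
  \<open>n powr (4/3 + 1/s)\<close> and \<open>n powr (8/3)\<close>.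

  The Szemeredi-Trotter theorem is proved with the crossing argument of Szekely. Join consecutive
  points on each line by a segment. Two segments cross only where their two lines meet, so
  there are at most as many ordered crossing pairs as ordered pairs of lines. On the other hand a
  straight-line graph without crossings has at most four times as many edges as vertices
  (\<open>card_edges_le\<close>), and restricting a general graph to a random set of vertices turns this into a
  strong lower bound for the number of crossings (\<open>crossing_inequality\<close>).
\<close>

section \<open>Straight-line graphs without crossings\<close>

type_synonym point = "real \<times> real"
type_synonym segment = "point \<times> point"

abbreviation lx :: "segment \<Rightarrow> real" where "lx e \<equiv> fst (fst e)"
abbreviation rx :: "segment \<Rightarrow> real" where "rx e \<equiv> fst (snd e)"

definition slope :: "segment \<Rightarrow> real" where
  "slope e = (snd (snd e) - snd (fst e)) / (rx e - lx e)"

definition height :: "segment \<Rightarrow> real \<Rightarrow> real" where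
  "height e x = snd (fst e) + slope e * (x - lx e)"

text \<open>
  Segments are stored with their left end first and are never vertical, so over their common range of
  abscissas they can be compared by height. A crossing is required to lie strictly inside that range:
  segments that share an end do not cross there.
\<close>

definition crossing :: "segment \<Rightarrow> segment \<Rightarrow> bool" where
  "crossing e f \<longleftrightarrow> e \<noteq> f \<and>
     (\<exists>x. lx e < x \<and> lx f < x \<and> x < rx e \<and> x < rx f \<and> height e x = height f x)"

lemma height_left [simp]: "height e (lx e) = snd (fst e)"
  by (simp add: height_def)

lemma height_right: "lx e < rx e \<Longrightarrow> height e (rx e) = snd (snd e)"
  by (simp add: height_def slope_def)

lemma height_from_right:
  "lx e < rx e \<Longrightarrow> height e x = snd (snd e) - slope e * (rx e - x)"
  using height_right[of e] by (simp add: height_def algebra_simps)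

text \<open>
  The only topological input to the planarity argument: the difference of the two heights is
  continuous, so it vanishes where the vertical order changes.
\<close>

lemma crossing_if_order_swaps:
  assumes "x1 < x2" "lx e \<le> x1" "x2 \<le> rx e" "lx f \<le> x1" "x2 \<le> rx f"
    and less1: "height e x1 < height f x1" and less2: "height f x2 < height e x2"
  shows "crossing e f"
proof -
  have "continuous_on {x1..x2} (\<lambda>x. height e x - height f x)"
    unfolding height_def by (intro continuous_intros)
  then obtain x where x: "x1 \<le> x" "x \<le> x2" "height e x - height f x = 0"
    using IVT'[of "\<lambda>x. height e x - height f x" x1 0 x2] assms by auto
  have "x \<noteq> x1" "x \<noteq> x2" "e \<noteq> f" using x less1 less2 by auto
  with x show ?thesis using assms unfolding crossing_def
    by (intro conjI exI[of _ x]) auto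
qed

locale segment_graph =
  fixes V :: "point set" and E :: "segment set"
  assumes finite_V: "finite V"
    and ends: "e \<in> E \<Longrightarrow> fst e \<in> V \<and> snd e \<in> V"
    and left_right: "e \<in> E \<Longrightarrow> lx e < rx e"
    and avoids: "\<lbrakk>e \<in> E; p \<in> V; lx e < fst p; fst p < rx e\<rbrakk> \<Longrightarrow> height e (fst p) \<noteq> snd p"
begin

lemma finite_E: "finite E"
proof (rule finite_subset)
  show "E \<subseteq> V \<times> V" using ends by (auto simp: mem_Times_iff)
qed (simp add: finite_V)

end

locale plane_segment_graph = segment_graph +
  assumes no_crossing: "\<lbrakk>e \<in> E; f \<in> E\<rbrakk> \<Longrightarrow> \<not> crossing e f"
begin

lemma no_swap:
  assumes "e \<in> E" "f \<in> E" "x1 < x2" "lx e \<le> x1" "x2 \<le> rx e" "lx f \<le> x1" "x2 \<le> rx f"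
    and "height e x1 < height f x1"
  shows "height e x2 \<le> height f x2"
  using crossing_if_order_swaps[of x1 x2 e f] no_crossing[of e f] assms by force

lemma same_left_slope_eq:
  assumes "e \<in> E" "f \<in> E" "fst e = fst f" "slope e = slope f"
  shows "e = f"
proof (rule ccontr)
  assume "e \<noteq> f"
  obtain x where "lx e < x" "x < min (rx e) (rx f)"
    using dense[of "lx e" "min (rx e) (rx f)"] left_right[of e] left_right[of f] assms by auto
  then have "crossing e f" using assms \<open>e \<noteq> f\<close> unfolding crossing_def
    by (intro conjI exI[of _ x]) (auto simp: height_def)
  then show False using no_crossing assms by blast
qed

lemma same_right_slope_eq:
  assumes "e \<in> E" "f \<in> E" "snd e = snd f" "slope e = slope f"
  shows "e = f"
proof (rule ccontr)
  assume "e \<noteq> f"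
  obtain x where "max (lx e) (lx f) < x" "x < rx e"
    using dense[of "max (lx e) (lx f)" "rx e"] left_right[of e] left_right[of f] assms by auto
  then have "crossing e f" using assms \<open>e \<noteq> f\<close> left_right unfolding crossing_def
    by (intro conjI exI[of _ x]) (auto simp: height_from_right)
  then show False using no_crossing assms by blast
qed

text \<open>
  A wedge is formed by two edges that leave the same vertex to the right and are neighbours in the
  order by slope; \<open>e\<close> is the lower and \<open>e'\<close> the upper one.
\<close>

definition wedge :: "segment \<Rightarrow> segment \<Rightarrow> bool" where
  "wedge e e' \<longleftrightarrow> e \<in> E \<and> e' \<in> E \<and> fst e = fst e' \<and> slope e < slope e' \<and>
     (\<forall>g\<in>E. fst g = fst e \<longrightarrow> \<not> (slope e < slope g \<and> slope g < slope e'))"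

text \<open>
  The wedge is cut off where the shorter of its two edges ends. As that end is itself included, a
  wedge always has a first vertex when it is swept from left to right.
\<close>

definition wedge_vertices :: "segment \<Rightarrow> segment \<Rightarrow> point set" where
  "wedge_vertices e e' = {p \<in> V. lx e < fst p \<and> fst p \<le> rx e \<and> fst p \<le> rx e' \<and>
     height e (fst p) \<le> snd p \<and> snd p \<le> height e' (fst p)}"

definition first_vertex :: "segment \<Rightarrow> segment \<Rightarrow> point" where
  "first_vertex e e' = arg_min_on fst (wedge_vertices e e')"

lemma wedge_height_less:
  assumes "wedge e e'" "lx e < x"
  shows "height e x < height e' x"
  using assms unfolding wedge_def height_def by auto

lemma wedge_unique_upper: "wedge e e' \<Longrightarrow> wedge e e'' \<Longrightarrow> e' = e''"
  unfolding wedge_def by (metis linorder_neqE_linordered_idom same_left_slope_eq)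

lemma wedge_unique_lower: "wedge e e' \<Longrightarrow> wedge f e' \<Longrightarrow> e = f"
  unfolding wedge_def by (metis linorder_neqE_linordered_idom same_left_slope_eq)

lemma first_vertex:
  assumes "wedge e e'"
  shows "first_vertex e e' \<in> wedge_vertices e e'"
    and "p \<in> wedge_vertices e e' \<Longrightarrow> fst (first_vertex e e') \<le> fst p"
proof -
  have fin: "finite (wedge_vertices e e')"
    by (simp add: wedge_vertices_def finite_V)
  have E: "e \<in> E" "e' \<in> E" "fst e = fst e'" using assms by (auto simp: wedge_def)
  have "snd e \<in> wedge_vertices e e' \<or> snd e' \<in> wedge_vertices e e'"
  proof (cases "rx e \<le> rx e'")
    case True
    then have "snd e \<in> wedge_vertices e e'"
      using E ends left_right[of e] height_right[of e] wedge_height_less[OF assms, of "rx e"]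
      by (auto simp: wedge_vertices_def)
    then show ?thesis ..
  next
    case False
    then have "snd e' \<in> wedge_vertices e e'"
      using E ends left_right[of e'] height_right[of e'] wedge_height_less[OF assms, of "rx e'"]
      by (auto simp: wedge_vertices_def)
    then show ?thesis ..
  qed
  then have ne: "wedge_vertices e e' \<noteq> {}" by blast
  show "first_vertex e e' \<in> wedge_vertices e e'"
    unfolding first_vertex_def by (rule arg_min_if_finite(1)[OF fin ne])
  show "fst (first_vertex e e') \<le> fst p" if "p \<in> wedge_vertices e e'"
    unfolding first_vertex_def by (rule arg_min_least[OF fin ne that])
qed

text \<open>
  The sweep has met no vertex yet, so every vertex in the open strip lies outside of the wedge. This
  is what traps an edge that reaches the wedge: it must have come in through one of the two sides.
\<close>

lemma before_first_vertex:
  assumes "wedge e e'" "p \<in> V" "lx e < fst p" "fst p < fst (first_vertex e e')"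
  shows "snd p < height e (fst p) \<or> height e' (fst p) < snd p"
proof (rule ccontr)
  assume "\<not> ?thesis"
  then have "p \<in> wedge_vertices e e'"
    using first_vertex(1)[OF assms(1)] assms(2-4) by (simp add: wedge_vertices_def)
  then show False using first_vertex(2)[OF assms(1)] assms(4) by fastforce
qed

lemma vertex_on_edge_is_right_end:
  assumes "e \<in> E" "w \<in> V" "lx e < fst w" "fst w \<le> rx e" "height e (fst w) = snd w"
  shows "w = snd e"
proof -
  have "fst w = rx e" using avoids[of e w] assms by fastforce
  then show ?thesis using assms height_right[OF left_right[of e]] by (auto simp: prod_eq_iff)
qed

text \<open>
  Suppose an edge \<open>g\<close> arrived at the right end of \<open>e\<close> from above \<open>e\<close>. It cannot start inside the
  wedge, where no vertex comes before that end. So it starts above \<open>e'\<close> or passes above the apex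
  of the wedge, and either way it has to cross \<open>e'\<close>. Hence \<open>e\<close>
  is the uppermost edge arriving at the first vertex, and that vertex determines \<open>e\<close>.
\<close>

lemma first_vertex_on_lower:
  assumes w: "wedge e e'" "snd e = first_vertex e e'" and g: "g \<in> E" "snd g = snd e"
  shows "slope e \<le> slope g"
proof (rule ccontr)
  assume less: "\<not> slope e \<le> slope g"
  have E: "e \<in> E" "e' \<in> E" "fst e = fst e'" using w by (auto simp: wedge_def)
  have e'r: "rx e \<le> rx e'"
    using first_vertex(1)[OF w(1)] w(2) by (auto simp: wedge_vertices_def)
  have lr: "lx e < rx e" "lx g < rx e" "lx e' < rx e"
    using left_right[OF E(1)] left_right[OF g(1)] E g by simp_all
  \<comment> \<open>The abscissa from which on both \<open>g\<close> and the wedge are present.\<close>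
  define x1 where "x1 = max (lx e) (lx g)"
  have above: "height e x < height g x" if "x < rx e" for x
    using that less lr g(2) mult_strict_right_mono[of "slope g" "slope e" "rx e - x"]
    by (simp add: height_from_right)
  have "height e' x1 < height g x1"
  proof (cases "lx g \<le> lx e")
    case True
    then show ?thesis using above[of "lx e"] lr E height_left[of e] by (simp add: x1_def)
  next
    case False
    then have "height e (lx g) < snd (fst g)" using above[of "lx g"] lr g by simp
    then have "height e' (lx g) < snd (fst g)"
      using before_first_vertex[OF w(1), of "fst g"] False lr g ends[OF g(1)] w(2) by auto
    then show ?thesis using False by (simp add: x1_def)
  qed
  then have "height e' (rx e) \<le> height g (rx e)"
    using no_swap[of e' g x1 "rx e"] E g lr e'r by (auto simp: x1_def)
  moreover have "height g (rx e) = height e (rx e)"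
    using g lr by (simp add: height_from_right)
  ultimately show False using wedge_height_less[OF w(1) lr(1)] by simp
qed

text \<open>
  The mirror image: the first vertex determines \<open>e'\<close> as the lowest edge arriving there.
\<close>

lemma first_vertex_on_upper:
  assumes w: "wedge e e'" "snd e' = first_vertex e e'" and g: "g \<in> E" "snd g = snd e'"
  shows "slope g \<le> slope e'"
proof (rule ccontr)
  assume less: "\<not> slope g \<le> slope e'"
  have E: "e \<in> E" "e' \<in> E" "fst e = fst e'" using w by (auto simp: wedge_def)
  have er: "rx e' \<le> rx e"
    using first_vertex(1)[OF w(1)] w(2) by (auto simp: wedge_vertices_def)
  have lr: "lx e' < rx e'" "lx g < rx e'" "lx e < rx e'"
    using left_right[OF E(2)] left_right[OF g(1)] E g by simp_all
  define x1 where "x1 = max (lx e') (lx g)"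
  have below: "height g x < height e' x" if "x < rx e'" for x
    using that less lr g(2) mult_strict_right_mono[of "slope e'" "slope g" "rx e' - x"]
    by (simp add: height_from_right)
  have "height g x1 < height e x1"
  proof (cases "lx g \<le> lx e'")
    case True
    then show ?thesis using below[of "lx e'"] lr E height_left[of e] by (simp add: x1_def)
  next
    case False
    then have "snd (fst g) < height e' (lx g)" using below[of "lx g"] lr g by simp
    then have "snd (fst g) < height e (lx g)"
      using before_first_vertex[OF w(1), of "fst g"] False lr g ends[OF g(1)] w(2) E by auto
    then show ?thesis using False by (simp add: x1_def)
  qed
  then have "height g (rx e') \<le> height e (rx e')"
    using no_swap[of g e x1 "rx e'"] E g lr er by (auto simp: x1_def)
  moreover have "height g (rx e') = height e' (rx e')"
    using g lr by (simp add: height_from_right)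
  ultimately show False using wedge_height_less[OF w(1), of "rx e'"] lr E by simp
qed

text \<open>
  If two wedges have the same first vertex \<open>w\<close> strictly inside both, then the apex of the one that
  starts further right lies outside of the other wedge, while \<open>w\<close> lies inside it. So one of the two
  edges at that apex would cross a side of the other wedge.
\<close>

lemma inner_first_vertex_left_ends:
  assumes w: "wedge e e'" "wedge f f'" "first_vertex e e' = w" "first_vertex f f' = w"
    and e: "height e (fst w) < snd w" "snd w < height e' (fst w)"
    and f: "height f (fst w) < snd w" "snd w < height f' (fst w)"
    and le: "lx e \<le> lx f"
  shows "fst e = fst f"
proof (rule ccontr)
  assume ne: "fst e \<noteq> fst f"
  have E: "e \<in> E" "e' \<in> E" "fst e' = fst e" "f \<in> E" "f' \<in> E" "fst f' = fst f"
    using w by (auto simp: wedge_def)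
  have we: "lx e < fst w" "fst w \<le> rx e" "fst w \<le> rx e'"
    using first_vertex(1)[OF w(1)] w(3) by (auto simp: wedge_vertices_def)
  have wf: "lx f < fst w" "fst w \<le> rx f" "fst w \<le> rx f'"
    using first_vertex(1)[OF w(2)] w(4) by (auto simp: wedge_vertices_def)
  have "snd (fst f) < height e (lx f) \<or> height e' (lx f) < snd (fst f)"
  proof (cases "lx e = lx f")
    case True
    then show ?thesis using ne E height_left[of e'] height_left[of e]
      by (cases "snd (fst e) < snd (fst f)") (auto simp: prod_eq_iff)
  next
    case False
    then show ?thesis
      using before_first_vertex[OF w(1), of "fst f"] ends E le wf w by auto
  qed
  then show False
  proof
    assume "snd (fst f) < height e (lx f)"
    then have "height f' (lx f) < height e (lx f)" using E height_left[of f'] by simp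
    then show False using no_swap[of f' e "lx f" "fst w"] E we wf le e f by force
  next
    assume "height e' (lx f) < snd (fst f)"
    then have "height e' (lx f) < height f (lx f)" by simp
    then show False using no_swap[of e' f "lx f" "fst w"] E we wf le e f by force
  qed
qed

lemma inner_first_vertex_unique:
  assumes w: "wedge e e'" "wedge f f'" "first_vertex e e' = w" "first_vertex f f' = w"
    and e: "height e (fst w) < snd w" "snd w < height e' (fst w)"
    and f: "height f (fst w) < snd w" "snd w < height f' (fst w)"
  shows "e = f"
proof -
  have same: "fst e = fst f"
    using inner_first_vertex_left_ends[of e e' f f' w] inner_first_vertex_left_ends[of f f' e e' w]
      assms by (metis linear)
  have E: "e \<in> E" "e' \<in> E" "fst e' = fst e" "f \<in> E" "f' \<in> E" "fst f' = fst f"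
    using w by (auto simp: wedge_def)
  have we: "lx e < fst w"
    using first_vertex(1)[OF w(1)] w(3) by (auto simp: wedge_vertices_def)
  have mono: "slope a < slope b" if "height a (fst w) < height b (fst w)" "fst a = fst b" "fst b = fst e" for a b
  proof -
    have "slope a * (fst w - lx e) < slope b * (fst w - lx e)" using that by (simp add: height_def)
    then show ?thesis using we by simp
  qed
  have "slope e < slope f'" "slope f < slope e'" using mono[of e f'] mono[of f e'] E same e f by auto
  then have "slope e = slope f" using w(1,2) E same unfolding wedge_def
    by (metis linorder_neqE_linordered_idom)
  then show ?thesis using same_left_slope_eq E same by blast
qed

lemma exists_wedge:
  assumes "e \<in> E" "f \<in> E" "fst f = fst e" "slope e < slope f"
  shows "\<exists>e'. wedge e e'"
proof -
  let ?S = "{g \<in> E. fst g = fst e \<and> slope e < slope g}"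
  have fin: "finite ?S" and ne: "?S \<noteq> {}" using finite_E assms by (simp, blast)
  define e' where "e' = arg_min_on slope ?S"
  have "e' \<in> ?S" unfolding e'_def by (rule arg_min_if_finite(1)[OF fin ne])
  moreover have "slope e' \<le> slope g" if "g \<in> ?S" for g
    unfolding e'_def by (rule arg_min_least[OF fin ne that])
  ultimately have "wedge e e'" using assms(1) unfolding wedge_def by force
  then show ?thesis ..
qed

text \<open>
  At every vertex at most one edge leaving to the right is steepest; every other edge is the lower
  side of exactly one wedge. Charge each wedge to its first vertex. A vertex is charged at most once
  by wedges whose lower edge ends there, at most once by wedges whose upper edge ends there, and at
  most once by wedges containing it strictly inside.
\<close>

theorem card_edges_le: "card E \<le> 4 * card V"
proof -
  define T where "T = {e \<in> E. \<forall>f\<in>E. fst f = fst e \<longrightarrow> slope f \<le> slope e}"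
  define W where "W = {(e, e'). wedge e e'}"
  define W1 where "W1 = {(e, e') \<in> W. snd e = first_vertex e e'}"
  define W2 where "W2 = {(e, e') \<in> W. snd e' = first_vertex e e'}"
  define W3 where "W3 = {(e, e') \<in> W. height e (fst (first_vertex e e')) < snd (first_vertex e e')
      \<and> snd (first_vertex e e') < height e' (fst (first_vertex e e'))}"
  have "W \<subseteq> E \<times> E" by (auto simp: W_def wedge_def)
  then have finW: "finite W" using finite_E finite_subset by blast
  have fv: "first_vertex e e' \<in> V" if "(e, e') \<in> W" for e e'
    using first_vertex(1)[of e e'] that by (auto simp: W_def wedge_vertices_def)
  have img: "(\<lambda>(e, e'). first_vertex e e') ` W \<subseteq> V"
  proof (intro image_subsetI)
    fix p assume "p \<in> W"
    with fv show "(case p of (e, e') \<Rightarrow> first_vertex e e') \<in> V" by (cases p) simp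
  qed
  have "W \<subseteq> W1 \<union> W2 \<union> W3"
  proof clarify
    fix e e' assume W: "(e, e') \<in> W" "(e, e') \<notin> W3" "(e, e') \<notin> W2"
    let ?w = "first_vertex e e'"
    have wd: "wedge e e'" and E: "e \<in> E" "e' \<in> E" "fst e = fst e'"
      using W by (auto simp: W_def wedge_def)
    have w: "?w \<in> wedge_vertices e e'" using first_vertex(1) wd by blast
    have "height e (fst ?w) = snd ?w \<or> height e' (fst ?w) = snd ?w"
      using W w by (auto simp: W3_def wedge_vertices_def)
    moreover have "?w \<noteq> snd e'" using W by (auto simp: W2_def)
    ultimately have "?w = snd e"
      using vertex_on_edge_is_right_end[of e ?w] vertex_on_edge_is_right_end[of e' ?w] E w
      by (auto simp: wedge_vertices_def)
    then show "(e, e') \<in> W1" using W by (auto simp: W1_def)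
  qed
  then have "card W \<le> card (W1 \<union> W2 \<union> W3)"
    by (intro card_mono) (auto intro: finite_subset[OF _ finW] simp: W1_def W2_def W3_def)
  also have "\<dots> \<le> card W1 + card W2 + card W3"
    using card_Un_le[of "W1 \<union> W2" W3] card_Un_le[of W1 W2] by linarith
  finally have cW: "card W \<le> card W1 + card W2 + card W3" .
  have "inj_on (\<lambda>(e, e'). first_vertex e e') W1"
  proof (rule inj_onI, clarify)
    fix e e' f f' assume "(e, e') \<in> W1" "(f, f') \<in> W1" and eq: "first_vertex e e' = first_vertex f f'"
    then have w: "wedge e e'" "wedge f f'" "snd e = first_vertex e e'" "snd f = first_vertex f f'"
      by (auto simp: W1_def W_def)
    have E: "e \<in> E" "f \<in> E" using w by (auto simp: wedge_def)
    have "slope e = slope f"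
      using first_vertex_on_lower[of e e' f] first_vertex_on_lower[of f f' e] w eq E by auto
    then have "e = f" using same_right_slope_eq[of e f] E w eq by auto
    then show "e = f \<and> e' = f'" using wedge_unique_upper w by blast
  qed
  then have c1: "card W1 \<le> card V"
    by (rule card_inj_on_le) (use img finite_V in \<open>auto simp only: W1_def\<close>)
  have "inj_on (\<lambda>(e, e'). first_vertex e e') W2"
  proof (rule inj_onI, clarify)
    fix e e' f f' assume "(e, e') \<in> W2" "(f, f') \<in> W2" and eq: "first_vertex e e' = first_vertex f f'"
    then have w: "wedge e e'" "wedge f f'" "snd e' = first_vertex e e'" "snd f' = first_vertex f f'"
      by (auto simp: W2_def W_def)
    have E: "e' \<in> E" "f' \<in> E" using w by (auto simp: wedge_def)
    have "slope e' = slope f'"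
      using first_vertex_on_upper[of e e' f'] first_vertex_on_upper[of f f' e'] w eq E by auto
    then have "e' = f'" using same_right_slope_eq[of e' f'] E w eq by auto
    then show "e = f \<and> e' = f'" using wedge_unique_lower w by blast
  qed
  then have c2: "card W2 \<le> card V"
    by (rule card_inj_on_le) (use img finite_V in \<open>auto simp only: W2_def\<close>)
  have "inj_on (\<lambda>(e, e'). first_vertex e e') W3"
  proof (rule inj_onI, clarify)
    fix e e' f f' assume *: "(e, e') \<in> W3" "(f, f') \<in> W3" and eq: "first_vertex e e' = first_vertex f f'"
    then have w: "wedge e e'" "wedge f f'" by (auto simp: W3_def W_def)
    have "e = f" using inner_first_vertex_unique[OF w refl] * eq by (auto simp: W3_def)
    then show "e = f \<and> e' = f'" using wedge_unique_upper w by blast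
  qed
  then have c3: "card W3 \<le> card V"
    by (rule card_inj_on_le) (use img finite_V in \<open>auto simp only: W3_def\<close>)
  have "inj_on fst T"
  proof (rule inj_onI)
    fix e f assume "e \<in> T" "f \<in> T" "fst e = fst f"
    then show "e = f"
      using same_left_slope_eq[of e f] unfolding T_def by (simp add: antisym)
  qed
  then have cT: "card T \<le> card V"
    by (rule card_inj_on_le) (use ends finite_V in \<open>auto simp: T_def\<close>)
  have "E \<subseteq> T \<union> fst ` W"
  proof
    fix e assume e: "e \<in> E"
    show "e \<in> T \<union> fst ` W"
    proof (cases "e \<in> T")
      case False
      then obtain f where "f \<in> E" "fst f = fst e" "slope e < slope f"
        using e by (auto simp: T_def)
      then obtain e' where "wedge e e'" using exists_wedge e by blast
      then have "fst (e, e') \<in> fst ` W" by (intro imageI) (simp add: W_def)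
      then show ?thesis by simp
    qed simp
  qed
  then have "card E \<le> card (T \<union> fst ` W)"
    by (intro card_mono) (auto simp: T_def finite_E finW)
  also have "\<dots> \<le> card T + card W"
    using card_Un_le[of T "fst ` W"] card_image_le[OF finW, of fst] by linarith
  finally show ?thesis using cW c1 c2 c3 cT by linarith
qed

end

section \<open>The crossing inequality\<close>

context segment_graph
begin

definition crossings :: "(segment \<times> segment) set" where
  "crossings = {(e, f) \<in> E \<times> E. crossing e f}"

lemma finite_crossings: "finite crossings"
  by (rule finite_subset[of _ "E \<times> E"]) (auto simp: crossings_def finite_E)

lemma subgraph:
  assumes "V' \<subseteq> V" "E' \<subseteq> E" "\<And>e. e \<in> E' \<Longrightarrow> fst e \<in> V' \<and> snd e \<in> V'"
  shows "segment_graph V' E'"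
  by unfold_locales (use assms finite_V finite_subset left_right avoids in \<open>blast+\<close>)

text \<open>
  Deleting one edge from every crossing pair leaves a graph without crossings.
\<close>

lemma card_edges_le_crossings: "card E \<le> 4 * card V + card crossings"
proof -
  define E' where "E' = E - fst ` crossings"
  interpret E': segment_graph V E'
    by (rule subgraph) (use ends in \<open>auto simp: E'_def\<close>)
  interpret E': plane_segment_graph V E'
  proof unfold_locales
    fix e f assume "e \<in> E'" "f \<in> E'"
    then have "(e, f) \<notin> crossings" "e \<in> E" "f \<in> E" unfolding E'_def by force+
    then show "\<not> crossing e f" by (simp add: crossings_def)
  qed
  have "card E \<le> card (E' \<union> fst ` crossings)"
    using finite_E finite_crossings by (intro card_mono) (auto simp: E'_def)
  also have "\<dots> \<le> card E' + card crossings"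
    using card_Un_le[of E' "fst ` crossings"] card_image_le[OF finite_crossings, of fst] by linarith
  finally show ?thesis using E'.card_edges_le by linarith
qed

end

text \<open>
  A random subset of \<open>V\<close> that contains each element independently with probability \<open>1 / q\<close>,
  expressed by counting: colour \<open>V\<close> with \<open>q\<close> colours and keep the elements of colour \<open>0\<close>. An object
  of \<open>X\<close> resting on \<open>j\<close> elements of \<open>V\<close> survives in a fraction \<open>1 / q ^ j\<close> of the colourings.
\<close>

lemma sum_card_surviving:
  fixes t :: "'x \<Rightarrow> 'v set" and q :: nat
  assumes "finite V" "finite X" "q > 0" and t: "\<And>x. x \<in> X \<Longrightarrow> t x \<subseteq> V \<and> card (t x) = j"
  shows "real (\<Sum>c\<in>V \<rightarrow>\<^sub>E {..<q}. card {x \<in> X. \<forall>v\<in>t x. c v = 0})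
           = real (card X) * (real q ^ card V / real q ^ j)"
proof -
  let ?C = "V \<rightarrow>\<^sub>E {..<q}"
  have finC: "finite ?C" using assms(1) by (intro finite_PiE) auto
  have count: "real (card {c \<in> ?C. \<forall>v\<in>t x. c v = 0}) = real q ^ card V / real q ^ j" if "x \<in> X" for x
  proof -
    have "{c \<in> ?C. \<forall>v\<in>t x. c v = 0} = (\<Pi>\<^sub>E v\<in>V. if v \<in> t x then {0} else {..<q})"
    proof (intro set_eqI iffI)
      fix c assume "c \<in> {c \<in> ?C. \<forall>v\<in>t x. c v = 0}"
      then show "c \<in> (\<Pi>\<^sub>E v\<in>V. if v \<in> t x then {0} else {..<q})"
        by (simp add: PiE_iff)
    next
      fix c assume c: "c \<in> (\<Pi>\<^sub>E v\<in>V. if v \<in> t x then {0} else {..<q})"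
      have "c v < q \<and> (v \<in> t x \<longrightarrow> c v = 0)" if "v \<in> V" for v
        using PiE_mem[OF c that] \<open>q > 0\<close> by (simp split: if_splits)
      then show "c \<in> {c \<in> ?C. \<forall>v\<in>t x. c v = 0}"
        using c t[OF that] by (auto simp: PiE_iff)
    qed
    then have "card {c \<in> ?C. \<forall>v\<in>t x. c v = 0} = (\<Prod>v\<in>V. if v \<in> t x then 1 else q)"
      using assms(1) by (simp add: card_PiE if_distrib cong: if_cong)
    also have "\<dots> = q ^ card (V - t x)"
      using assms(1) by (simp add: prod.If_cases Diff_eq)
    also have "card (V - t x) = card V - j"
      using t[OF that] assms(1) by (metis card_Diff_subset finite_subset)
    finally have "real (card {c \<in> ?C. \<forall>v\<in>t x. c v = 0}) = real q ^ (card V - j)"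
      by (simp only: of_nat_power)
    also have "\<dots> = real q ^ card V / real q ^ j"
      using t[OF that] assms(1,3) card_mono[of V "t x"] by (intro power_diff) auto
    finally show ?thesis .
  qed
  have "real (\<Sum>c\<in>?C. card {x \<in> X. \<forall>v\<in>t x. c v = 0}) = real (\<Sum>x\<in>X. card {c \<in> ?C. \<forall>v\<in>t x. c v = 0})"
    using sum_multicount_gen[OF finC assms(2), of "\<lambda>c x. \<forall>v\<in>t x. c v = 0"
        "\<lambda>x. card {c \<in> ?C. \<forall>v\<in>t x. c v = 0}"] by simp
  also have "\<dots> = (\<Sum>x\<in>X. real q ^ card V / real q ^ j)" using count by simp
  finally show ?thesis by simp
qed

context segment_graph
begin

text \<open>
  Apply \<open>card_edges_le_crossings\<close> to the graph induced on a random set of vertices. Vertices, edges and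
  crossing pairs survive with probability \<open>1 / q\<close>, \<open>1 / q\<^sup>2\<close> and \<open>1 / q ^ 4\<close>, the last because crossing
  edges are assumed to have four different ends. Comparing expectations and multiplying by \<open>q\<^sup>2\<close>
  gives the claim, in which \<open>q\<close> can still be chosen.
\<close>

theorem crossing_inequality:
  fixes q :: nat
  assumes "q > 0"
    and disjoint: "\<And>e f. (e, f) \<in> crossings \<Longrightarrow> card {fst e, snd e, fst f, snd f} = 4"
  shows "real (card E) \<le> 4 * real (card V) * real q + real (card crossings) / (real q)\<^sup>2"
proof -
  have qpos: "real q > 0" using assms(1) by simp
  let ?C = "V \<rightarrow>\<^sub>E {..<q}"
  let ?tE = "\<lambda>e. {fst e, snd e}"
  let ?tX = "\<lambda>(e, f). {fst e, snd e, fst f, snd f}"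
  let ?S = "\<lambda>t X c. {x \<in> X. \<forall>v\<in>t x. c v = (0::nat)}"
  have step: "card (?S ?tE E c) \<le> 4 * card (?S (\<lambda>v. {v}) V c) + card (?S ?tX crossings c)" for c
  proof -
    interpret S: segment_graph "?S (\<lambda>v. {v}) V c" "?S ?tE E c"
    proof (rule subgraph)
      fix e assume "e \<in> ?S ?tE E c"
      then show "fst e \<in> ?S (\<lambda>v. {v}) V c \<and> snd e \<in> ?S (\<lambda>v. {v}) V c"
        using ends[of e] by simp
    qed blast+
    have eq: "S.crossings = ?S ?tX crossings c"
    proof (rule set_eqI)
      fix x
      obtain e f :: segment where x: "x = (e, f)" by (cases x)
      show "x \<in> S.crossings \<longleftrightarrow> x \<in> ?S ?tX crossings c"
        unfolding x S.crossings_def crossings_def by (simp add: conj_ac)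
    qed
    show ?thesis using S.card_edges_le_crossings unfolding eq .
  qed
  have "real (\<Sum>c\<in>?C. card (?S ?tE E c))
      \<le> real (\<Sum>c\<in>?C. 4 * card (?S (\<lambda>v. {v}) V c) + card (?S ?tX crossings c))"
    by (rule of_nat_mono, rule sum_mono, rule step)
  also have "\<dots> = 4 * real (\<Sum>c\<in>?C. card (?S (\<lambda>v. {v}) V c)) + real (\<Sum>c\<in>?C. card (?S ?tX crossings c))"
    by (simp only: sum.distrib of_nat_add sum_distrib_left[symmetric] of_nat_mult of_nat_numeral)
  finally have le: "real (\<Sum>c\<in>?C. card (?S ?tE E c)) \<le> \<dots>" .
  have 1: "real (\<Sum>c\<in>?C. card (?S ?tE E c)) = real (card E) * (real q ^ card V / real q ^ 2)"
  proof (rule sum_card_surviving[OF finite_V finite_E assms(1)])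
    fix e assume "e \<in> E"
    then have "fst e \<noteq> snd e" using left_right[of e] by auto
    then show "?tE e \<subseteq> V \<and> card (?tE e) = 2" using ends[OF \<open>e \<in> E\<close>] by simp
  qed
  have 2: "real (\<Sum>c\<in>?C. card (?S (\<lambda>v. {v}) V c)) = real (card V) * (real q ^ card V / real q ^ 1)"
    by (rule sum_card_surviving[OF finite_V finite_V assms(1)]) simp
  have 3: "real (\<Sum>c\<in>?C. card (?S ?tX crossings c)) = real (card crossings) * (real q ^ card V / real q ^ 4)"
  proof (rule sum_card_surviving[OF finite_V finite_crossings assms(1)])
    fix x assume x: "x \<in> crossings"
    obtain e f where ef: "x = (e, f)" by (cases x)
    then have "e \<in> E" "f \<in> E" using x by (auto simp: crossings_def)
    then show "?tX x \<subseteq> V \<and> card (?tX x) = 4" using ends disjoint[of e f] x ef by simp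
  qed
  have "real q ^ card V * (real (card E) / (real q)\<^sup>2)
      \<le> real q ^ card V * (4 * real (card V) / real q + real (card crossings) / real q ^ 4)"
    using le unfolding 1 2 3 by (simp add: algebra_simps)
  then have "real (card E) / (real q)\<^sup>2 \<le> 4 * real (card V) / real q + real (card crossings) / real q ^ 4"
    by (rule mult_left_le_imp_le) (simp add: assms(1))
  then have "real (card E) / (real q)\<^sup>2 * (real q)\<^sup>2
      \<le> (4 * real (card V) / real q + real (card crossings) / real q ^ 4) * (real q)\<^sup>2"
    by (rule mult_right_mono) simp
  moreover have "a / x\<^sup>2 * x\<^sup>2 = a" "(b / x + c / x ^ 4) * x\<^sup>2 = b * x + c / x\<^sup>2"
    if "x > 0" for a b c x :: real
    using that by (simp_all add: distrib_right power2_eq_square power4_eq_xxxx)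
  moreover note this[OF qpos]
  ultimately show ?thesis by (simp only:)
qed

end

section \<open>The Szemeredi-Trotter theorem\<close>

text \<open>
  The line with equation \<open>y = a * x + b\<close> is represented by the pair \<open>(a, b)\<close>.
\<close>

type_synonym line = "real \<times> real"

definition on_line :: "point \<Rightarrow> line \<Rightarrow> bool" where
  "on_line p l \<longleftrightarrow> snd p = fst l * fst p + snd l"

definition incidences :: "point set \<Rightarrow> line set \<Rightarrow> (point \<times> line) set" where
  "incidences P L = {(p, l) \<in> P \<times> L. on_line p l}"

definition consecutive :: "point set \<Rightarrow> line \<Rightarrow> segment \<Rightarrow> bool" where
  "consecutive P l e \<longleftrightarrow> fst e \<in> P \<and> snd e \<in> P \<and> on_line (fst e) l \<and> on_line (snd e) l \<and> lx e < rx e \<and>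
     (\<forall>p\<in>P. on_line p l \<longrightarrow> \<not> (lx e < fst p \<and> fst p < rx e))"

lemma lines_meet_once:
  assumes "on_line p l" "on_line p l'" "on_line q l" "on_line q l'" "l \<noteq> l'"
  shows "fst p = fst q"
proof -
  have "(fst l - fst l') * (fst p - fst q) = 0"
    using assms(1-4) by (simp add: on_line_def algebra_simps)
  moreover have "fst l \<noteq> fst l'"
    using assms by (auto simp: on_line_def prod_eq_iff)
  ultimately show ?thesis by simp
qed

lemma height_on_line:
  assumes "consecutive P l e"
  shows "on_line (x, height e x) l"
proof -
  have "snd (snd e) - snd (fst e) = fst l * (rx e - lx e)" "rx e - lx e \<noteq> 0"
    using assms by (auto simp: consecutive_def on_line_def algebra_simps)
  then have "slope e = fst l" by (simp add: slope_def)
  then show ?thesis using assms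
    by (simp add: consecutive_def on_line_def height_def algebra_simps)
qed

lemma consecutive_unique:
  assumes "consecutive P l e" "consecutive P l f" "lx e < x" "x < rx e" "lx f < x" "x < rx f"
  shows "e = f"
proof -
  have e: "fst e \<in> P" "snd e \<in> P" "on_line (fst e) l" "on_line (snd e) l"
    and f: "fst f \<in> P" "snd f \<in> P" "on_line (fst f) l" "on_line (snd f) l"
    using assms(1,2) by (simp_all add: consecutive_def)
  have gap: "\<not> (lx g < fst p \<and> fst p < rx g)" if "consecutive P l g" "p \<in> P" "on_line p l" for g p
    using that by (simp add: consecutive_def)
  have "lx e = lx f"
    using gap[OF assms(1) f(1) f(3)] gap[OF assms(2) e(1) e(3)] assms(3-6) by linarith
  moreover have "rx e = rx f"
    using gap[OF assms(1) f(2) f(4)] gap[OF assms(2) e(2) e(4)] assms(3-6) by linarith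
  ultimately show ?thesis using e f
    by (simp add: on_line_def prod_eq_iff)
qed

lemma consecutive_line_unique:
  assumes "consecutive P l e" "consecutive P l' e"
  shows "l = l'"
  using lines_meet_once[of "fst e" l l' "snd e"] assms by (auto simp: consecutive_def)

text \<open>
  Send an incidence \<open>(p, l)\<close> to the segment from \<open>p\<close> to the next point on \<open>l\<close>. This is injective and
  defined unless \<open>p\<close> is the last point on \<open>l\<close>, which happens at most once for each line.
\<close>

lemma card_incidences_le_consecutive:
  assumes fin: "finite P" "finite L"
  shows "card (incidences P L) \<le> card L + card {e. \<exists>l\<in>L. consecutive P l e}"
proof -
  let ?E = "{e. \<exists>l\<in>L. consecutive P l e}"
  define later where "later = (\<lambda>(p::point) (l::line). {q \<in> P. on_line q l \<and> fst p < fst q})"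
  define A where "A = {(p, l) \<in> incidences P L. later p l = {}}"
  define B where "B = {(p, l) \<in> incidences P L. later p l \<noteq> {}}"
  have "finite (incidences P L)"
    by (rule finite_subset[of _ "P \<times> L"]) (auto simp: incidences_def fin)
  have "inj_on snd A"
  proof (rule inj_onI)
    fix a b assume *: "a \<in> A" "b \<in> A" "snd a = snd b"
    obtain p l where a: "a = (p, l)" by (cases a)
    obtain q where b: "b = (q, l)" using * a by (cases b) simp
    have "later p l = {}" "later q l = {}" and on: "p \<in> P" "q \<in> P" "on_line p l" "on_line q l"
      using *(1,2) by (simp_all add: a b A_def incidences_def)
    then have "\<not> fst p < fst q" "\<not> fst q < fst p" unfolding later_def by blast+
    then have "fst p = fst q" by simp
    with on show "a = b" by (simp add: a b on_line_def prod_eq_iff)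
  qed
  then have cA: "card A \<le> card L"
    by (rule card_inj_on_le) (auto simp: A_def incidences_def fin)
  define nxt where "nxt = (\<lambda>p l. arg_min_on fst (later p l))"
  have nxt: "consecutive P l (p, nxt p l)" if "(p, l) \<in> B" for p l
  proof -
    have ne: "later p l \<noteq> {}" and fl: "finite (later p l)" and p: "p \<in> P" "on_line p l"
      using that fin by (auto simp: B_def incidences_def later_def)
    have "nxt p l \<in> later p l" unfolding nxt_def by (rule arg_min_if_finite(1)[OF fl ne])
    moreover have "fst (nxt p l) \<le> fst r" if "r \<in> later p l" for r
      unfolding nxt_def by (rule arg_min_least[OF fl ne that])
    ultimately show ?thesis using p unfolding consecutive_def later_def by force
  qed
  have "inj_on (\<lambda>(p, l). (p, nxt p l)) B"
  proof (rule inj_onI)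
    fix a b assume *: "a \<in> B" "b \<in> B" "(case a of (p, l) \<Rightarrow> (p, nxt p l)) = (case b of (p, l) \<Rightarrow> (p, nxt p l))"
    obtain p l where a: "a = (p, l)" by (cases a)
    obtain p' l' where b: "b = (p', l')" by (cases b)
    have "p = p'" "nxt p l = nxt p' l'" using * by (auto simp only: a b prod.case prod.inject)
    moreover have "consecutive P l (p, nxt p l)" "consecutive P l' (p', nxt p' l')"
      using * nxt by (simp_all add: a b)
    ultimately have "l = l'" using consecutive_line_unique[of P l _ l'] by simp
    with \<open>p = p'\<close> show "a = b" by (simp add: a b)
  qed
  moreover have "(\<lambda>(p, l). (p, nxt p l)) ` B \<subseteq> ?E"
  proof (intro image_subsetI)
    fix a assume a: "a \<in> B"
    obtain p l where pl: "a = (p, l)" by (cases a)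
    have "consecutive P l (p, nxt p l)" "l \<in> L"
      using nxt[of p l] a by (simp_all add: pl B_def incidences_def)
    then show "(case a of (p, l) \<Rightarrow> (p, nxt p l)) \<in> ?E" unfolding pl by auto
  qed
  moreover have "finite ?E"
    by (rule finite_subset[of _ "P \<times> P"]) (auto simp: consecutive_def fin)
  ultimately have cB: "card B \<le> card ?E" by (rule card_inj_on_le)
  have "incidences P L = A \<union> B" by (auto simp: A_def B_def)
  then show ?thesis using card_Un_le[of A B] cA cB by simp
qed

text \<open>
  The segments between consecutive points form a straight-line graph, and two crossing segments are
  determined by the two lines that carry them: these lines meet in a single point, and on
  each line at most one segment has that point in its interior. The same point is not an end
  of either segment, so the four ends are different and the crossing inequality applies.
\<close>

theorem Szemeredi_Trotter:
  fixes q :: nat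
  assumes fin: "finite P" "finite L" and "q > 0"
  shows "real (card (incidences P L)) \<le> card L + 4 * card P * q + (card L)\<^sup>2 / q\<^sup>2"
proof -
  define E where "E = {e. \<exists>l\<in>L. consecutive P l e}"
  interpret segment_graph P E
  proof unfold_locales
    fix e p assume e: "e \<in> E" and p: "p \<in> P" "lx e < fst p" "fst p < rx e"
    obtain l where l: "consecutive P l e" using e by (auto simp: E_def)
    have "\<not> on_line p l" using l p by (auto simp: consecutive_def)
    then show "height e (fst p) \<noteq> snd p" using height_on_line[OF l, of "fst p"] by auto
  qed (auto simp: E_def consecutive_def fin)
  have meet: "\<exists>l\<in>L. \<exists>l'\<in>L. \<exists>x. consecutive P l e \<and> consecutive P l' f \<and> l \<noteq> l' \<and>
      lx e < x \<and> x < rx e \<and> lx f < x \<and> x < rx f \<and> on_line (x, height e x) l \<and> on_line (x, height e x) l'"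
    if ef: "(e, f) \<in> crossings" for e f
  proof -
    have *: "e \<in> E" "f \<in> E" "crossing e f" using ef by (simp_all add: crossings_def)
    obtain l l' where l: "l \<in> L" "l' \<in> L" "consecutive P l e" "consecutive P l' f"
      using *(1,2) unfolding E_def by blast
    obtain x where x: "lx e < x" "x < rx e" "lx f < x" "x < rx f" "height e x = height f x" "e \<noteq> f"
      using *(3) unfolding crossing_def by blast
    have "l \<noteq> l'" using consecutive_unique[of P l e f x] l x by blast
    moreover have "on_line (x, height e x) l" by (rule height_on_line[OF l(3)])
    moreover have "on_line (x, height e x) l'" unfolding x(5) by (rule height_on_line[OF l(4)])
    ultimately show ?thesis using l x(1-4) by blast
  qed
  have "card {fst e, snd e, fst f, snd f} = 4" if ef: "(e, f) \<in> crossings" for e f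
  proof -
    obtain l l' x where *: "consecutive P l e" "consecutive P l' f" "l \<noteq> l'"
      "lx e < x" "x < rx e" "lx f < x" "x < rx f" "on_line (x, height e x) l" "on_line (x, height e x) l'"
      using meet[OF ef] by blast
    have meet_at: "fst v = x" if "on_line v l" "on_line v l'" for v
      using lines_meet_once[OF that *(8,9) *(3)] by simp
    have "fst v \<noteq> x" if "v \<in> {fst e, snd e, fst f, snd f}" for v
      using that *(4-7) by auto
    then have off: "\<not> (on_line v l \<and> on_line v l')" if "v \<in> {fst e, snd e, fst f, snd f}" for v
      using that meet_at by blast
    have "on_line (fst e) l" "on_line (snd e) l" "on_line (fst f) l'" "on_line (snd f) l'"
      using *(1,2) by (simp_all add: consecutive_def)
    then have "fst e \<noteq> fst f" "fst e \<noteq> snd f" "snd e \<noteq> fst f" "snd e \<noteq> snd f"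
      using off[of "fst e"] off[of "snd e"] by auto
    moreover have "fst e \<noteq> snd e" "fst f \<noteq> snd f" using *(4-7) by auto
    ultimately have "distinct [fst e, snd e, fst f, snd f]" by simp
    then have "card (set [fst e, snd e, fst f, snd f]) = 4" by (subst distinct_card) auto
    then show ?thesis by simp
  qed
  note ineq = crossing_inequality[OF \<open>q > 0\<close> this]
  define line where "line = (\<lambda>e. THE l. consecutive P l e)"
  have line: "line e = l" if "consecutive P l e" for e l
    unfolding line_def using that consecutive_line_unique by blast
  have "inj_on (\<lambda>(e, f). (line e, line f)) crossings"
  proof (rule inj_onI)
    fix a b assume *: "a \<in> crossings" "b \<in> crossings"
      "(case a of (e, f) \<Rightarrow> (line e, line f)) = (case b of (e, f) \<Rightarrow> (line e, line f))"
    obtain e f where a: "a = (e, f)" by (cases a)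
    obtain g h where b: "b = (g, h)" by (cases b)
    obtain l l' x where A: "consecutive P l e" "consecutive P l' f" "l \<noteq> l'"
      "lx e < x" "x < rx e" "lx f < x" "x < rx f" "on_line (x, height e x) l" "on_line (x, height e x) l'"
      using meet *(1) unfolding a by blast
    obtain m m' y where B: "consecutive P m g" "consecutive P m' h" "m \<noteq> m'"
      "lx g < y" "y < rx g" "lx h < y" "y < rx h" "on_line (y, height g y) m" "on_line (y, height g y) m'"
      using meet *(2) unfolding b by blast
    have m: "m = l" "m' = l'" using * line A(1,2) B(1,2) by (auto simp: a b)
    have "x = y" using lines_meet_once[OF A(8,9) B(8,9)[unfolded m] A(3)] by simp
    then show "a = b" using consecutive_unique A B m unfolding a b by blast
  qed
  moreover have "(\<lambda>(e, f). (line e, line f)) ` crossings \<subseteq> L \<times> L"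
  proof (intro image_subsetI)
    fix a assume a: "a \<in> crossings"
    obtain e f where ef: "a = (e, f)" by (cases a)
    show "(case a of (e, f) \<Rightarrow> (line e, line f)) \<in> L \<times> L"
      using meet[of e f] a line unfolding ef by fastforce
  qed
  ultimately have "card crossings \<le> card (L \<times> L)"
    by (rule card_inj_on_le) (simp add: fin)
  then have "card crossings \<le> (card L)\<^sup>2"
    by (simp add: card_cartesian_product power2_eq_square)
  then have "real (card crossings) \<le> real ((card L)\<^sup>2)" by (rule of_nat_mono)
  then have "real (card crossings) / (real q)\<^sup>2 \<le> (card L)\<^sup>2 / q\<^sup>2"
    by (simp add: divide_right_mono)
  moreover have "real (card (incidences P L)) \<le> real (card L + card E)"
    unfolding E_def by (rule of_nat_mono[OF card_incidences_le_consecutive[OF fin]])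
  ultimately show ?thesis using ineq by simp
qed

section \<open>Points on a line and pairs with a prescribed dot product\<close>

text \<open>
  When the \<open>i\<close>-th coordinate dominates all differences, points in a common cell of length \<open>\<delta> / 2\<close> of
  that coordinate are closer than \<open>\<delta>\<close> to each other, so each cell holds at most one point.
\<close>

lemma card_separated_le:
  fixes S :: "(real ^ 2) set" and i :: 2
  assumes "S \<subseteq> unit_square" "\<delta> > 0"
    and sep: "\<And>P Q. \<lbrakk>P \<in> S; Q \<in> S; P \<noteq> Q\<rbrakk> \<Longrightarrow> \<delta> \<le> dist P Q"
    and dom: "\<And>P Q j. \<lbrakk>P \<in> S; Q \<in> S\<rbrakk> \<Longrightarrow> \<bar>P $ j - Q $ j\<bar> \<le> \<bar>P $ i - Q $ i\<bar>"
  shows "real (card S) \<le> 2 / \<delta> + 1"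
proof -
  define cell where "cell = (\<lambda>P::real^2. nat \<lfloor>2 * P $ i / \<delta>\<rfloor>)"
  have in01: "0 \<le> P $ i" "P $ i \<le> 1" if "P \<in> S" for P
    using that assms(1) by (auto simp: unit_square_def)
  have "inj_on cell S"
  proof (rule inj_onI, rule ccontr)
    fix P Q assume PQ: "P \<in> S" "Q \<in> S" "cell P = cell Q" "P \<noteq> Q"
    have "0 \<le> 2 * P $ i / \<delta>" "0 \<le> 2 * Q $ i / \<delta>" using in01 PQ \<open>\<delta> > 0\<close> by simp_all
    then have "\<lfloor>2 * P $ i / \<delta>\<rfloor> = \<lfloor>2 * Q $ i / \<delta>\<rfloor>"
      using PQ(3) by (simp add: cell_def eq_nat_nat_iff)
    then have "\<bar>2 * P $ i / \<delta> - 2 * Q $ i / \<delta>\<bar> < 1" by linarith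
    also have "2 * P $ i / \<delta> - 2 * Q $ i / \<delta> = 2 * (P $ i - Q $ i) / \<delta>"
      by (simp add: diff_divide_distrib right_diff_distrib)
    finally have "\<bar>2 * (P $ i - Q $ i)\<bar> < \<delta>" using \<open>\<delta> > 0\<close> by simp
    then have close: "2 * \<bar>P $ i - Q $ i\<bar> < \<delta>" by linarith
    have "dist P Q \<le> (\<Sum>j\<in>UNIV. \<bar>(P - Q) $ j\<bar>)"
      unfolding dist_norm by (rule norm_le_l1_cart)
    also have "\<dots> \<le> 2 * \<bar>P $ i - Q $ i\<bar>"
      using dom[OF PQ(1,2), of 1] dom[OF PQ(1,2), of 2] by (simp add: sum_2)
    finally show False using close sep[OF PQ(1,2,4)] by simp
  qed
  moreover have "cell ` S \<subseteq> {..nat \<lfloor>2 / \<delta>\<rfloor>}"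
    using in01 \<open>\<delta> > 0\<close> by (auto simp: cell_def intro!: nat_mono floor_mono divide_right_mono)
  ultimately have "card S \<le> card {..nat \<lfloor>2 / \<delta>\<rfloor>}" by (rule card_inj_on_le) simp
  then have "real (card S) \<le> real (nat \<lfloor>2 / \<delta>\<rfloor>) + 1" by simp
  also have "real (nat \<lfloor>2 / \<delta>\<rfloor>) \<le> 2 / \<delta>" using \<open>\<delta> > 0\<close> by simp
  finally show ?thesis by simp
qed

text \<open>
  The condition \<open>P \<bullet> Q = \<alpha>\<close> forces differences of such points \<open>P\<close> to be orthogonal to \<open>Q\<close>, so the
  coordinate in which \<open>Q\<close> is smaller in absolute value dominates, and the packing bound applies.
  For \<open>Q = 0\<close> there are no such points, because \<open>\<alpha> \<noteq> 0\<close>.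
\<close>

lemma card_on_line_le:
  fixes E :: "(real ^ 2) set"
  assumes E: "adaptable s C0 n E" and "n \<ge> 1" "s > 0" "\<alpha> \<noteq> 0"
  shows "real (card {P \<in> E. P \<bullet> Q = \<alpha>}) \<le> 3 * real n powr (1 / s)"
proof (cases "Q = 0")
  case True
  then show ?thesis using \<open>\<alpha> \<noteq> 0\<close> by simp
next
  case False
  let ?S = "{P \<in> E. P \<bullet> Q = \<alpha>}"
  let ?\<delta> = "real n powr (- 1 / s)"
  have eq: "(P $ 1 - P' $ 1) * Q $ 1 = - (P $ 2 - P' $ 2) * Q $ 2" if "P \<in> ?S" "P' \<in> ?S" for P P'
    using that by (simp add: inner_vec_def sum_2 algebra_simps)
  have eqa: "\<bar>P $ 1 - P' $ 1\<bar> * \<bar>Q $ 1\<bar> = \<bar>P $ 2 - P' $ 2\<bar> * \<bar>Q $ 2\<bar>" if "P \<in> ?S" "P' \<in> ?S" for P P'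
    using arg_cong[OF eq[OF that], of abs] by (simp only: abs_mult abs_minus_cancel)
  have "\<exists>i. \<forall>P\<in>?S. \<forall>P'\<in>?S. \<forall>j. \<bar>P $ j - P' $ j\<bar> \<le> \<bar>P $ i - P' $ i\<bar>"
  proof (cases "\<bar>Q $ 1\<bar> \<le> \<bar>Q $ 2\<bar>")
    case True
    with False have "\<bar>Q $ 2\<bar> > 0" by (auto simp: vec_eq_iff forall_2)
    moreover have "\<bar>P $ 2 - P' $ 2\<bar> * \<bar>Q $ 2\<bar> \<le> \<bar>P $ 1 - P' $ 1\<bar> * \<bar>Q $ 2\<bar>"
      if "P \<in> ?S" "P' \<in> ?S" for P P'
      using eqa[OF that] mult_left_mono[OF True, of "\<bar>P $ 1 - P' $ 1\<bar>"] by simp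
    ultimately show ?thesis by (intro exI[of _ 1]) (simp add: forall_2)
  next
    case False
    then have "\<bar>Q $ 1\<bar> > 0" by simp
    moreover have "\<bar>P $ 1 - P' $ 1\<bar> * \<bar>Q $ 1\<bar> \<le> \<bar>P $ 2 - P' $ 2\<bar> * \<bar>Q $ 1\<bar>"
      if "P \<in> ?S" "P' \<in> ?S" for P P'
      using eqa[OF that] mult_left_mono[of "\<bar>Q $ 2\<bar>" "\<bar>Q $ 1\<bar>" "\<bar>P $ 2 - P' $ 2\<bar>"] False by simp
    ultimately show ?thesis by (intro exI[of _ 2]) (simp add: forall_2)
  qed
  then obtain i where "\<forall>P\<in>?S. \<forall>P'\<in>?S. \<forall>j. \<bar>P $ j - P' $ j\<bar> \<le> \<bar>P $ i - P' $ i\<bar>" ..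
  then have "real (card ?S) \<le> 2 / ?\<delta> + 1"
    using E \<open>n \<ge> 1\<close> by (intro card_separated_le[of _ _ i]) (auto simp: adaptable_def)
  moreover have "2 / ?\<delta> = 2 * real n powr (1 / s)" by (simp add: powr_minus_divide)
  moreover have "1 \<le> real n powr (1 / s)" using assms(2,3) by (intro ge_one_powr_ge_zero) auto
  ultimately show ?thesis by linarith
qed

definition dot_pairs :: "real \<Rightarrow> (real ^ 2) set \<Rightarrow> ((real ^ 2) \<times> (real ^ 2)) set" where
  "dot_pairs \<alpha> E = {(P, Q) \<in> E \<times> E. P \<bullet> Q = \<alpha>}"

lemma finite_dot_pairs: "finite E \<Longrightarrow> finite (dot_pairs \<alpha> E)"
  by (rule finite_subset[of _ "E \<times> E"]) (auto simp: dot_pairs_def)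

text \<open>
  Points \<open>Q\<close> with second coordinate \<open>0\<close> give vertical lines \<open>P \<bullet> Q = \<alpha>\<close>, which have no slope. Since
  parallel lines are disjoint, each \<open>P\<close> is on at most one of them, and they contribute at most \<open>n\<close>
  pairs. For all other \<open>Q\<close> the slope and the intercept of the line determine \<open>Q\<close>, because \<open>\<alpha> \<noteq> 0\<close>.
\<close>

lemma card_dot_pairs_le_incidences:
  fixes q :: nat
  assumes "finite E" "card E = n" "\<alpha> \<noteq> 0" "q > 0"
  shows "real (card (dot_pairs \<alpha> E)) \<le> 2 * real n + 4 * (real n * real q) + (real n)\<^sup>2 / (real q)\<^sup>2"
proof -
  define A where "A = {(P, Q) \<in> dot_pairs \<alpha> E. Q $ 2 = 0}"
  define B where "B = {(P, Q) \<in> dot_pairs \<alpha> E. Q $ 2 \<noteq> 0}"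
  have "inj_on fst A"
  proof (rule inj_onI)
    fix a b assume *: "a \<in> A" "b \<in> A" "fst a = fst b"
    obtain P Q where a: "a = (P, Q)" by (cases a)
    obtain Q' where b: "b = (P, Q')" using * a by (cases b) simp
    have "Q $ 2 = 0" "Q' $ 2 = 0" "P $ 1 * Q $ 1 = \<alpha>" "P $ 1 * Q' $ 1 = \<alpha>"
      using *(1,2) unfolding a b A_def dot_pairs_def by (auto simp: inner_vec_def sum_2)
    then have "Q = Q'" using \<open>\<alpha> \<noteq> 0\<close> by (auto simp: vec_eq_iff forall_2)
    then show "a = b" by (simp add: a b)
  qed
  then have cA: "card A \<le> n" unfolding assms(2)[symmetric]
    by (rule card_inj_on_le) (auto simp: A_def dot_pairs_def assms(1))
  define pt where "pt = (\<lambda>P::real^2. (P $ 1, P $ 2))"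
  define ln where "ln = (\<lambda>Q::real^2. (- (Q $ 1) / Q $ 2, \<alpha> / Q $ 2))"
  let ?L = "ln ` {Q \<in> E. Q $ 2 \<noteq> 0}"
  have "inj_on (\<lambda>(P, Q). (pt P, ln Q)) B"
  proof (rule inj_onI)
    fix a b assume *: "a \<in> B" "b \<in> B"
      "(case a of (P, Q) \<Rightarrow> (pt P, ln Q)) = (case b of (P, Q) \<Rightarrow> (pt P, ln Q))"
    obtain P Q where a: "a = (P, Q)" by (cases a)
    obtain P' Q' where b: "b = (P', Q')" by (cases b)
    have nz: "Q $ 2 \<noteq> 0" "Q' $ 2 \<noteq> 0" using *(1,2) by (auto simp: a b B_def)
    have eq: "P $ 1 = P' $ 1" "P $ 2 = P' $ 2" "Q $ 1 / Q $ 2 = Q' $ 1 / Q' $ 2" "\<alpha> / Q $ 2 = \<alpha> / Q' $ 2"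
      using *(3) by (auto simp: a b pt_def ln_def)
    from eq(4) have "Q $ 2 = Q' $ 2" using nz \<open>\<alpha> \<noteq> 0\<close> by (simp add: frac_eq_eq)
    with eq(3) nz have "Q $ 1 = Q' $ 1" by simp
    show "a = b" using eq(1,2) \<open>Q $ 2 = Q' $ 2\<close> \<open>Q $ 1 = Q' $ 1\<close>
      by (simp add: a b vec_eq_iff forall_2)
  qed
  moreover have "(\<lambda>(P, Q). (pt P, ln Q)) ` B \<subseteq> incidences (pt ` E) ?L"
    by (auto simp: B_def dot_pairs_def incidences_def on_line_def pt_def ln_def
        inner_vec_def sum_2 field_simps)
  moreover have "finite (incidences (pt ` E) ?L)"
    by (rule finite_subset[of _ "pt ` E \<times> ?L"]) (auto simp: incidences_def assms(1))
  ultimately have "card B \<le> card (incidences (pt ` E) ?L)" by (rule card_inj_on_le)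
  also have "real \<dots> \<le> card ?L + 4 * card (pt ` E) * q + (card ?L)\<^sup>2 / q\<^sup>2"
    using assms by (intro Szemeredi_Trotter) auto
  also have "\<dots> \<le> n + 4 * n * q + n\<^sup>2 / q\<^sup>2"
  proof -
    have "card ?L \<le> card {Q \<in> E. Q $ 2 \<noteq> 0}" using assms(1) by (intro card_image_le) auto
    also have "\<dots> \<le> n" unfolding assms(2)[symmetric] using assms(1) by (intro card_mono) auto
    finally have L: "card ?L \<le> n" .
    have P: "card (pt ` E) \<le> n" using card_image_le[OF assms(1), of pt] assms(2) by simp
    have "card ?L + 4 * card (pt ` E) * q \<le> n + 4 * n * q"
      using L P by (intro add_mono mult_mono) auto
    moreover have "real ((card ?L)\<^sup>2) / q\<^sup>2 \<le> real (n\<^sup>2) / q\<^sup>2"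
      using L by (intro divide_right_mono of_nat_mono power_mono) auto
    ultimately show ?thesis by linarith
  qed
  finally have cB: "real (card B) \<le> n + 4 * n * q + n\<^sup>2 / q\<^sup>2" by simp
  have "dot_pairs \<alpha> E = A \<union> B" by (auto simp: A_def B_def)
  then have "real (card (dot_pairs \<alpha> E)) \<le> real (card A) + real (card B)"
    using card_Un_le[of A B] by (metis of_nat_add of_nat_mono)
  then show ?thesis using cA cB by simp
qed

text \<open>
  The choice \<open>q \<approx> n powr (1/3)\<close> balances the two main terms \<open>n * q\<close> and \<open>n\<^sup>2 / q\<^sup>2\<close>.
\<close>

lemma card_dot_pairs_le:
  assumes "finite E" "card E = n" "n \<ge> 1" "\<alpha> \<noteq> 0"
  shows "real (card (dot_pairs \<alpha> E)) \<le> 11 * real n powr (4 / 3)"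
proof -
  define r where "r = real n powr (1 / 3)"
  have r1: "r \<ge> 1" unfolding r_def using assms(3) by (intro ge_one_powr_ge_zero) auto
  have r3: "r ^ 3 = real n" unfolding r_def using assms(3) by (simp add: powr_power)
  have r4: "real n powr (4 / 3) = r ^ 4" unfolding r_def using assms(3) by (simp add: powr_power)
  define q where "q = nat \<lceil>r\<rceil>"
  have q: "r \<le> real q" "real q \<le> 2 * r" "q > 0" unfolding q_def using r1 by linarith+
  have "real (card (dot_pairs \<alpha> E)) \<le> 2 * real n + 4 * (real n * real q) + (real n)\<^sup>2 / (real q)\<^sup>2"
    by (rule card_dot_pairs_le_incidences) (use assms q in auto)
  also have "\<dots> \<le> 2 * r ^ 4 + 4 * (2 * r ^ 4) + r ^ 4"
  proof (intro add_mono mult_left_mono)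
    show "real n \<le> r ^ 4" unfolding r3[symmetric] using r1 by (intro power_increasing) auto
    have "real n * real q \<le> r ^ 3 * (2 * r)" using q r1 r3 by (intro mult_mono) auto
    then show "real n * real q \<le> 2 * r ^ 4" by (simp add: power_numeral_reduce)
    have "(real n)\<^sup>2 / (real q)\<^sup>2 \<le> (r ^ 3)\<^sup>2 / r\<^sup>2"
      unfolding r3 using q r1 by (intro divide_left_mono power_mono mult_pos_pos) auto
    also have "\<dots> = r ^ 4" using r1 by (simp add: field_simps power_numeral_reduce)
    finally show "(real n)\<^sup>2 / (real q)\<^sup>2 \<le> r ^ 4" .
  qed auto
  finally show ?thesis by (simp add: r4)
qed

section \<open>Counting chains\<close>

lemma k_chains_Nil: "k_chains [] E = (\<lambda>P. [P]) ` E"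
  by (auto simp: k_chains_def length_Suc_conv)

lemma k_chains_Cons:
  "k_chains (\<alpha> # \<alpha>s) E = {P # R | P R. P \<in> E \<and> R \<in> k_chains \<alpha>s E \<and> P \<bullet> hd R = \<alpha>}"
proof (intro set_eqI)
  fix S show "S \<in> k_chains (\<alpha> # \<alpha>s) E \<longleftrightarrow> S \<in> {P # R | P R. P \<in> E \<and> R \<in> k_chains \<alpha>s E \<and> P \<bullet> hd R = \<alpha>}"
  proof (cases S)
    case Nil
    then show ?thesis by (simp add: k_chains_def)
  next
    case (Cons P R)
    show ?thesis
      by (cases R) (auto simp: Cons k_chains_def All_less_Suc2)
  qed
qed

lemma finite_k_chains: "finite E \<Longrightarrow> finite (k_chains \<alpha>s E)"
  by (rule finite_subset[OF _ finite_lists_length_eq[of E "length \<alpha>s + 1"]])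
    (auto simp: k_chains_def)

lemma card_k_chains_Cons_le:
  assumes "finite E" and M: "\<And>Q. real (card {P \<in> E. P \<bullet> Q = \<alpha>}) \<le> M"
  shows "real (card (k_chains (\<alpha> # \<alpha>s) E)) \<le> M * real (card (k_chains \<alpha>s E))"
proof -
  let ?F = "\<lambda>R. (\<lambda>P. P # R) ` {P \<in> E. P \<bullet> hd R = \<alpha>}"
  have "k_chains (\<alpha> # \<alpha>s) E \<subseteq> (\<Union>R\<in>k_chains \<alpha>s E. ?F R)" by (auto simp: k_chains_Cons)
  then have "card (k_chains (\<alpha> # \<alpha>s) E) \<le> card (\<Union>R\<in>k_chains \<alpha>s E. ?F R)"
    using assms(1) finite_k_chains by (intro card_mono) auto
  also have "\<dots> \<le> (\<Sum>R\<in>k_chains \<alpha>s E. card (?F R))"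
    using finite_k_chains[OF assms(1)] by (rule card_UN_le)
  also have "real \<dots> \<le> (\<Sum>R\<in>k_chains \<alpha>s E. M)"
    unfolding of_nat_sum using M by (intro sum_mono) (simp add: card_image inj_on_def)
  finally show ?thesis by (simp add: mult.commute)
qed

text \<open>
  The condition with value \<open>\<beta>\<close>, which links the first pair to the rest of the chain, is dropped.
\<close>

lemma card_k_chains_Cons_Cons_le:
  assumes "finite E"
  shows "card (k_chains (\<alpha> # \<beta> # \<alpha>s) E) \<le> card (dot_pairs \<alpha> E) * card (k_chains \<alpha>s E)"
proof -
  let ?f = "\<lambda>((P, Q), R). P # Q # R"
  have fin: "finite (dot_pairs \<alpha> E \<times> k_chains \<alpha>s E)"
    using assms finite_dot_pairs finite_k_chains by blast
  have "k_chains (\<alpha> # \<beta> # \<alpha>s) E \<subseteq> ?f ` (dot_pairs \<alpha> E \<times> k_chains \<alpha>s E)"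
    by (force simp: k_chains_Cons dot_pairs_def image_iff)
  then have "card (k_chains (\<alpha> # \<beta> # \<alpha>s) E) \<le> card (dot_pairs \<alpha> E \<times> k_chains \<alpha>s E)"
    using fin surj_card_le by blast
  then show ?thesis by (simp add: card_cartesian_product)
qed

lemma card_k_chains_single_le:
  assumes "finite E"
  shows "card (k_chains [\<alpha>] E) \<le> card (dot_pairs \<alpha> E)"
proof -
  have "k_chains [\<alpha>] E \<subseteq> (\<lambda>(P, Q). [P, Q]) ` dot_pairs \<alpha> E"
    by (auto simp: k_chains_Cons k_chains_Nil dot_pairs_def image_iff)
  then show ?thesis using finite_dot_pairs[OF assms] surj_card_le by blast
qed

text \<open>
  The two sides agree except for two more factors \<open>log 2 n \<ge> 1\<close> on the right.
\<close>

lemma chain_bound_add_3: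
  assumes "n \<ge> 2" "s > 0"
  shows "real n powr (4 / 3) * real n powr (1 / s) * chain_bound k s n \<le> chain_bound (k + 3) s n"
proof -
  let ?l = "log 2 (real n)"
  have log: "1 \<le> ?l" using assms(1) by simp
  have step: "real n powr (4 / 3) * real n powr (1 / s) * (?l powr a * real n powr b)
      \<le> ?l powr a' * real n powr b'"
    if "a \<le> a'" "4 / 3 + 1 / s + b = b'" for a a' b b'
  proof -
    have "real n powr (4 / 3) * real n powr (1 / s) * (?l powr a * real n powr b)
        = ?l powr a * real n powr b'"
      using assms by (simp add: that(2)[symmetric] powr_add)
    also have "\<dots> \<le> ?l powr a' * real n powr b'"
      using powr_mono[OF that(1) log] by (intro mult_right_mono) auto
    finally show ?thesis .
  qed
  have mods: "(k + 3) mod 3 = k mod 3" "(1::nat) \<noteq> 0" "(2::nat) \<noteq> 0" "(2::nat) \<noteq> 1" by simp_all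
  consider "k mod 3 = 0" | "k mod 3 = 1" | "k mod 3 = 2" by linarith
  then show ?thesis
  proof cases
    case 1
    show ?thesis unfolding chain_bound_def mods(1) 1
      by (simp only: if_True simp_thms, rule step) (use \<open>s > 0\<close> in \<open>simp_all add: field_simps\<close>)
  next
    case 2
    show ?thesis unfolding chain_bound_def mods(1) 2
      by (simp only: mods if_True if_False simp_thms, rule step) (use \<open>s > 0\<close> in \<open>simp_all add: field_simps\<close>)
  next
    case 3
    show ?thesis unfolding chain_bound_def mods(1) 3
      by (simp only: mods if_False simp_thms, rule step) (use \<open>s > 0\<close> in \<open>simp_all add: field_simps\<close>)
  qed
qed

lemma chain_bound_small:
  assumes "n \<ge> 2" "s > 0"
  shows "real n powr (4 / 3) = chain_bound 1 s n"
    and "real n powr (1 / s) * real n powr (4 / 3) \<le> chain_bound 2 s n"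
    and "real n powr (4 / 3) * real n powr (4 / 3) = chain_bound 3 s n"
proof -
  let ?l = "log 2 (real n)"
  have log: "1 \<le> ?l" using assms(1) by simp
  show "real n powr (4 / 3) = chain_bound 1 s n"
    using log by (simp add: chain_bound_def)
  show "real n powr (4 / 3) * real n powr (4 / 3) = chain_bound 3 s n"
    using log by (simp add: chain_bound_def flip: powr_add)
  have "1 \<le> ?l powr 2" using log by (intro ge_one_powr_ge_zero) auto
  then have "real n powr (1 / s + 4 / 3) \<le> ?l powr 2 * real n powr (1 / s + 4 / 3)"
    using mult_right_mono[of 1 "?l powr 2" "real n powr (1 / s + 4 / 3)"] by simp
  then show "real n powr (1 / s) * real n powr (4 / 3) \<le> chain_bound 2 s n"
    using assms(2) by (simp add: chain_bound_def add.commute flip: powr_add)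
qed

text \<open>
  Both basic bounds are weakened to the common constant \<open>11\<close>, so that a type of length \<open>k\<close>, which is
  split into at most \<open>k\<close> applications of them, gets the constant \<open>11 ^ k\<close>.
\<close>

theorem card_k_chains_le:
  assumes E: "adaptable s C0 n E" and "n \<ge> 2" "s > 0"
    and "\<alpha>s \<noteq> []" "\<forall>\<alpha>\<in>set \<alpha>s. \<alpha> \<noteq> 0"
  shows "real (card (k_chains \<alpha>s E)) \<le> 11 ^ length \<alpha>s * chain_bound (length \<alpha>s) s n"
  using assms(4,5)
proof (induction "length \<alpha>s" arbitrary: \<alpha>s rule: less_induct)
  case less
  let ?A = "real n powr (4 / 3)" and ?B = "real n powr (1 / s)"
  have fin: "finite E" and card: "card E = n" using E by (auto simp: adaptable_def)
  have A: "real (card (dot_pairs \<alpha> E)) \<le> 11 * ?A" if "\<alpha> \<noteq> 0" for \<alpha>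
    using card_dot_pairs_le[OF fin card _ that] \<open>n \<ge> 2\<close> by simp
  have B: "real (card {P \<in> E. P \<bullet> Q = \<alpha>}) \<le> 11 * ?B" if "\<alpha> \<noteq> 0" for \<alpha> Q
  proof -
    have "real (card {P \<in> E. P \<bullet> Q = \<alpha>}) \<le> 3 * ?B"
      using card_on_line_le[OF E _ \<open>s > 0\<close> that] \<open>n \<ge> 2\<close> by simp
    also have "\<dots> \<le> 11 * ?B" by simp
    finally show ?thesis .
  qed
  have single: "real (card (k_chains [\<alpha>] E)) \<le> 11 * ?A" if "\<alpha> \<noteq> 0" for \<alpha>
    using card_k_chains_single_le[OF fin, of \<alpha>] A[OF that] by linarith
  have pair: "real (card (k_chains (\<alpha> # \<beta> # \<beta>s) E)) \<le> 11 * ?A * real (card (k_chains \<beta>s E))"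
    if "\<alpha> \<noteq> 0" for \<alpha> \<beta> \<beta>s
  proof -
    have "real (card (k_chains (\<alpha> # \<beta> # \<beta>s) E)) \<le> real (card (dot_pairs \<alpha> E)) * real (card (k_chains \<beta>s E))"
      using card_k_chains_Cons_Cons_le[OF fin] by (metis of_nat_mono of_nat_mult)
    also have "\<dots> \<le> 11 * ?A * real (card (k_chains \<beta>s E))"
      using A[OF that] by (intro mult_right_mono) auto
    finally show ?thesis .
  qed
  have single_more: "real (card (k_chains (\<alpha> # \<beta>s) E)) \<le> 11 * ?B * real (card (k_chains \<beta>s E))"
    if "\<alpha> \<noteq> 0" for \<alpha> \<beta>s
    using card_k_chains_Cons_le[OF fin B[OF that]] .
  note small = chain_bound_small[OF \<open>n \<ge> 2\<close> \<open>s > 0\<close>]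
  from less.prems(1) consider a where "\<alpha>s = [a]" | a b where "\<alpha>s = [a, b]" | a b c where "\<alpha>s = [a, b, c]"
    | a b c \<beta>s where "\<alpha>s = a # b # c # \<beta>s" "\<beta>s \<noteq> []"
    by (metis list.exhaust)
  then show ?case
  proof cases
    case 1
    then show ?thesis using single[of a] less.prems(2) small(1) by simp
  next
    case (2 a b)
    have "real (card (k_chains [a, b] E)) \<le> 11 * ?B * real (card (k_chains [b] E))"
      using single_more less.prems(2) 2 by simp
    also have "\<dots> \<le> 11 * ?B * (11 * ?A)"
      using single[of b] less.prems(2) 2 by (intro mult_left_mono) auto
    also have "\<dots> = 11\<^sup>2 * (?B * ?A)" by simp
    also have "\<dots> \<le> 11\<^sup>2 * chain_bound 2 s n" using small(2) by (intro mult_left_mono) auto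
    finally show ?thesis using 2 by (simp add: numeral_2_eq_2)
  next
    case (3 a b c)
    have "real (card (k_chains [a, b, c] E)) \<le> 11 * ?A * real (card (k_chains [c] E))"
      using pair less.prems(2) 3 by simp
    also have "\<dots> \<le> 11 * ?A * (11 * ?A)"
      using single[of c] less.prems(2) 3 by (intro mult_left_mono) auto
    also have "\<dots> = 11\<^sup>2 * chain_bound 3 s n" using small(3) by simp
    also have "\<dots> \<le> 11 ^ 3 * chain_bound 3 s n"
      unfolding small(3)[symmetric] by (intro mult_right_mono) auto
    finally show ?thesis using 3 by (simp add: numeral_3_eq_3)
  next
    case (4 a b c \<beta>s)
    have "real (card (k_chains (a # b # c # \<beta>s) E)) \<le> 11 * ?A * real (card (k_chains (c # \<beta>s) E))"
      using pair less.prems(2) 4 by simp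
    also have "\<dots> \<le> 11 * ?A * (11 * ?B * real (card (k_chains \<beta>s E)))"
      using single_more[of c \<beta>s] less.prems(2) 4 by (intro mult_left_mono) auto
    also have "\<dots> \<le> 11 * ?A * (11 * ?B * (11 ^ length \<beta>s * chain_bound (length \<beta>s) s n))"
      using less.hyps[of \<beta>s] less.prems(2) 4 by (intro mult_left_mono) auto
    also have "\<dots> = 11 ^ (length \<beta>s + 2) * (?A * ?B * chain_bound (length \<beta>s) s n)"
      by (simp add: power_add)
    also have "\<dots> \<le> 11 ^ (length \<beta>s + 2) * chain_bound (length \<beta>s + 3) s n"
      using chain_bound_add_3[OF \<open>n \<ge> 2\<close> \<open>s > 0\<close>] by (intro mult_left_mono) auto
    also have "\<dots> \<le> 11 ^ (length \<beta>s + 3) * chain_bound (length \<beta>s + 3) s n"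
      by (intro mult_right_mono power_increasing) (auto simp: chain_bound_def)
    finally show ?thesis using 4 by (simp add: numeral_3_eq_3)
  qed
qed

theorem corollary1p7:
  fixes k :: nat and s C0 :: real
  assumes "k \<ge> 1" and "0 < s" and "s \<le> 2" and "C0 > 0"
  shows "\<exists>(C::real) (N::nat). C > 0 \<and>
    (\<forall>n > N. \<forall>(E :: (real ^ 2) set) (\<alpha>s :: real list).
       adaptable s C0 n E \<longrightarrow> length \<alpha>s = k \<longrightarrow> (\<forall>\<alpha> \<in> set \<alpha>s. \<alpha> \<noteq> 0) \<longrightarrow>
       real (card (k_chains \<alpha>s E)) \<le> C * chain_bound k s n)"
proof (rule exI[of _ "11 ^ k"], rule exI[of _ 1], intro conjI allI impI)
  fix n :: nat and E :: "(real ^ 2) set" and \<alpha>s :: "real list"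
  assume "1 < n" "adaptable s C0 n E" "length \<alpha>s = k" "\<forall>\<alpha>\<in>set \<alpha>s. \<alpha> \<noteq> 0"
  then show "real (card (k_chains \<alpha>s E)) \<le> 11 ^ k * chain_bound k s n"
    using card_k_chains_le[of s C0 n E \<alpha>s] assms(1,2) by fastforce
qed simp

end
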